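(* Let $G$ be a Lie group acting smoothly on $\mathbb{R}^n$, let $f:\mathbb{R}^n\to\overline{\mathbb{R}}$ be lower semicontinuous and $G$-invariant, let $\overline{x}\in\operatorname{dom} f$, and let $L\subseteq\mathbb{R}^n$ be a linear subspace with $T_{\overline{x}}G\overline{x}+L=\mathbb{R}^n$. Write $\vec L_{\overline{x}}:=L+\{\overline{x}\}$. (i) If there exist $\rho,\kappa>0$ and $\beta\ge 1$ such that $$\forall x\in B_\rho(\overline{x})\cap\vec L_{\overline{x}},\quad (f(x)-f(\overline{x}))_+\ge\kappa\, d(x,[f\le f(\overline{x})])^\beta,$$ then $f$ has growth exponent $\beta$ at $\overline{x}$. (ii) If there exist $r,c,\ell>0$ and $\alpha\in[0,1)$ such that $$\forall x\in B_r(\overline{x})\cap[0<f-f(\overline{x})<\ell]\cap\vec L_{\overline{x}},\quad d(0,\overline\partial f(x))\ge c(f(x)-f(\overline{x}))^\alpha,$$ then $f$ has Kurdyka-Łojasiewicz exponent $\alpha$ at $\overline{x}$.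
   Context: $\overline{\mathbb{R}}:=\mathbb{R}\cup\{\infty\}$; $\operatorname{dom} f:=\{x: f(x)<\infty\}$; $d(x,S):=\inf\{|x-y|:y\in S\}$ (with $\inf\emptyset=\infty$); $t_+:=\max\{t,0\}$; $[f\le \ell]:=\{x: f(x)\le \ell\}$, and similarly for other relations; $B_r(x)$ is the ball of radius $r$ centered at $x$. $f$ is $G$-invariant if $f(g\cdot x)=f(x)$ for all $g\in G$, $x\in\mathbb{R}^n$. The orbit $G\overline{x}=\{g\cdot\overline{x}:g\in G\}$ is an immersed submanifold of $\mathbb{R}^n$, whose tangent space at $\overline{x}$, $T_{\overline{x}}G\overline{x}$, is the image of the differential at the identity $e$ of the map $G\ni g\mapsto g\cdot\overline{x}$, viewed as a subspace of $\mathbb{R}^n$. Subdifferentials of $f$ at $\overline{x}\in\operatorname{dom} f$: $\widehat\partial f(\overline{x}):=\{v: f(x)\ge f(\overline{x})+\langle v,x-\overline{x}\rangle+o(|x-\overline{x}|)\text{ near }\overline{x}\}$; $\partial f(\overline{x})$ is the set of $v$ for which there are $x_k$ and $v_k\in\widehat\partial f(x_k)$ with $(x_k,f(x_k),v_k)\to(\overline{x},f(\overline{x}),v)$; $\partial^\infty f(\overline{x})$ is the set of $v$ for which there are $x_k$, $v_k\in\widehat\partial f(x_k)$ and $\tau_k\downarrow 0$ with $(x_k,f(x_k),\tau_kv_k)\to(\overline{x},f(\overline{x}),v)$; the Clarke subdifferential is $\overline\partial f(\overline{x}):=\overline{\mathrm{co}}[\partial f(\overline{x})+\partial^\infty f(\overline{x})]$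 (closed convex hull). $f$ has growth exponent $\beta\in[1,\infty)$ at $\overline{x}\in\operatorname{dom} f$ if there exist $\rho,\kappa>0$ such that $(f(x)-f(\overline{x}))_+\ge\kappa\, d(x,[f\le f(\overline{x})])^\beta$ for all $x\in B_\rho(\overline{x})$. $f$ has Kurdyka-Łojasiewicz exponent $\alpha\in[0,1)$ at $\overline{x}\in\operatorname{dom} f$ if there exist $r,\ell,c>0$ such that $d(0,\overline\partial f(x))\ge c(f(x)-f(\overline{x}))^\alpha$ for all $x\in B_r(\overline{x})$ with $0<f(x)-f(\overline{x})<\ell$. *)

theory Defs
  imports "HOL-Analysis.Analysis" "HOL-Algebra.Group_Action" "HOL-Library.Landau_Symbols"
begin

section \<open>Smooth maps, manifolds, Lie groups and smooth actions\<close>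

text \<open>
  \<open>Ck_on k S f\<close> is meant for open \<open>S\<close> in a \<^emph>\<open>finite-dimensional\<close> normed space; there, continuity of
  all iterated directional derivatives is the same as being of class \<open>C\<^sup>k\<close>.
\<close>

primrec Ck_on ::
  "nat \<Rightarrow> 'a::real_normed_vector set \<Rightarrow> ('a \<Rightarrow> 'b::real_normed_vector) \<Rightarrow> bool" where
  "Ck_on 0 S f \<longleftrightarrow> continuous_on S f"
| "Ck_on (Suc k) S f \<longleftrightarrow>
     (\<forall>x\<in>S. f differentiable (at x)) \<and>
     (\<forall>v. Ck_on k S (\<lambda>x. frechet_derivative f (at x) v))"

definition smooth_on :: "'a::real_normed_vector set \<Rightarrow> ('a \<Rightarrow> 'b::real_normed_vector) \<Rightarrow> bool" where
  "smooth_on S f \<longleftrightarrow> (\<forall>k. Ck_on k S f)"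

text \<open>
  A chart is a pair \<open>(U, \<phi>)\<close>; only the values of \<open>\<phi>\<close> on \<open>U\<close> matter. The model space is an
  arbitrary finite-dimensional normed space rather than a \<open>euclidean_space\<close>, because the latter
  class has positive dimension and would exclude discrete Lie groups.
\<close>

type_synonym ('p, 'm) atlas = "('p set \<times> ('p \<Rightarrow> 'm)) set"

definition smooth_manifold :: "'p topology \<Rightarrow> ('p, 'm::real_normed_vector) atlas \<Rightarrow> bool" where
  "smooth_manifold T A \<longleftrightarrow>
     (\<exists>B::'m set. finite B \<and> span B = UNIV) \<and>
     Hausdorff_space T \<and> second_countable T \<and>
     topspace T = (\<Union>(U, \<phi>)\<in>A. U) \<and>
     (\<forall>(U, \<phi>)\<in>A. openin T U \<and> open (\<phi> ` U) \<and>
        homeomorphic_map (subtopology T U) (top_of_set (\<phi> ` U)) \<phi>) \<and>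
     (\<forall>(U, \<phi>)\<in>A. \<forall>(V, \<psi>)\<in>A. smooth_on (\<phi> ` (U \<inter> V)) (\<psi> \<circ> inv_into U \<phi>))"

definition smooth_map ::
  "'p topology \<Rightarrow> ('p, 'm::real_normed_vector) atlas \<Rightarrow>
   'q topology \<Rightarrow> ('q, 'k::real_normed_vector) atlas \<Rightarrow> ('p \<Rightarrow> 'q) \<Rightarrow> bool" where
  "smooth_map T A T' A' F \<longleftrightarrow>
     continuous_map T T' F \<and>
     (\<forall>(U, \<phi>)\<in>A. \<forall>(V, \<psi>)\<in>A'.
        smooth_on (\<phi> ` {p \<in> U. F p \<in> V}) (\<psi> \<circ> F \<circ> inv_into U \<phi>))"

definition prod_atlas :: "('p, 'm) atlas \<Rightarrow> ('q, 'k) atlas \<Rightarrow> ('p \<times> 'q, 'm \<times> 'k) atlas" where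
  "prod_atlas A A' = {(U \<times> V, map_prod \<phi> \<psi>) |U \<phi> V \<psi>. (U, \<phi>) \<in> A \<and> (V, \<psi>) \<in> A'}"

definition std_atlas :: "('a, 'a) atlas" where
  "std_atlas = {(UNIV, id)}"

locale lie_group = group G
  for G :: "('g, 'z) monoid_scheme" (structure) +
  fixes T :: "'g topology" and A :: "('g, 'm::real_normed_vector) atlas"
  assumes manifold: "smooth_manifold T A"
    and topspace_eq: "topspace T = carrier G"
    and smooth_mult: "smooth_map (prod_topology T T) (prod_atlas A A) T A (\<lambda>(g, h). g \<otimes> h)"
    and smooth_inv: "smooth_map T A T A (\<lambda>g. inv g)"

locale smooth_action = lie_group G T A + group_action G UNIV act
  for G :: "('g, 'z) monoid_scheme" (structure)
    and T :: "'g topology" and A :: "('g, 'm::real_normed_vector) atlas"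
    and act :: "'g \<Rightarrow> 'x::real_normed_vector \<Rightarrow> 'x" +
  assumes smooth_act:
    "smooth_map (prod_topology T euclidean) (prod_atlas A std_atlas) euclidean std_atlas
       (\<lambda>(g, x). act g x)"

text \<open>
  The tangent space of the orbit through \<open>x\<close>: the image of the differential at the identity of
  \<open>g \<mapsto> g \<cdot> x\<close>, read in a chart around the identity. All such charts give the same image, so
  taking the union over them merely avoids choosing one.
\<close>

definition orbit_tangent_space ::
  "('g, 'z) monoid_scheme \<Rightarrow> ('g, 'm::real_normed_vector) atlas \<Rightarrow>
   ('g \<Rightarrow> 'x::real_normed_vector \<Rightarrow> 'x) \<Rightarrow> 'x \<Rightarrow> 'x set" where
  "orbit_tangent_space G A act x =
     (\<Union>(U, \<phi>)\<in>{(U, \<phi>) \<in> A. \<one>\<^bsub>G\<^esub> \<in> U}.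
        range (frechet_derivative (\<lambda>u. act (inv_into U \<phi> u) x) (at (\<phi> \<one>\<^bsub>G\<^esub>))))"

definition group_invariant :: "('g, 'z) monoid_scheme \<Rightarrow> ('g \<Rightarrow> 'x \<Rightarrow> 'x) \<Rightarrow> ('x \<Rightarrow> 'b) \<Rightarrow> bool" where
  "group_invariant G act f \<longleftrightarrow> (\<forall>g\<in>carrier G. \<forall>x. f (act g x) = f x)"


section \<open>Subdifferentials, growth and Kurdyka-Lojasiewicz exponents\<close>

definition lower_semicontinuous :: "('a::topological_space \<Rightarrow> ereal) \<Rightarrow> bool" where
  "lower_semicontinuous f \<longleftrightarrow> (\<forall>x. f x \<le> Liminf (at x) f)"

definition effective_domain :: "('a \<Rightarrow> ereal) \<Rightarrow> 'a set" where
  "effective_domain f = {x. f x < \<infinity>}"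

text \<open>Unlike \<open>infdist\<close>, which is \<open>0\<close> on the empty set, this distance is \<open>\<infinity>\<close> there.\<close>

definition edist_set :: "'a::metric_space \<Rightarrow> 'a set \<Rightarrow> ereal" where
  "edist_set x S = (INF y\<in>S. ereal (dist x y))"

definition regular_subdiff :: "('a::real_inner \<Rightarrow> ereal) \<Rightarrow> 'a \<Rightarrow> 'a set" where
  "regular_subdiff f x = {v. x \<in> effective_domain f \<and>
     (\<exists>e :: 'a \<Rightarrow> real. e \<in> o[at x](\<lambda>y. norm (y - x)) \<and>
        (\<forall>\<^sub>F y in at x. f y \<ge> f x + ereal (v \<bullet> (y - x) + e y)))}"

definition limiting_subdiff :: "('a::real_inner \<Rightarrow> ereal) \<Rightarrow> 'a \<Rightarrow> 'a set" where
  "limiting_subdiff f x = {v. x \<in> effective_domain f \<and>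
     (\<exists>X V. (\<forall>k::nat. V k \<in> regular_subdiff f (X k)) \<and>
        X \<longlonglongrightarrow> x \<and> (\<lambda>k. f (X k)) \<longlonglongrightarrow> f x \<and> V \<longlonglongrightarrow> v)}"

definition horizon_subdiff :: "('a::real_inner \<Rightarrow> ereal) \<Rightarrow> 'a \<Rightarrow> 'a set" where
  "horizon_subdiff f x = {v. x \<in> effective_domain f \<and>
     (\<exists>X V \<tau>. (\<forall>k::nat. V k \<in> regular_subdiff f (X k)) \<and>
        (\<forall>k. 0 < \<tau> k) \<and> decseq \<tau> \<and> \<tau> \<longlonglongrightarrow> (0::real) \<and>
        X \<longlonglongrightarrow> x \<and> (\<lambda>k. f (X k)) \<longlonglongrightarrow> f x \<and> (\<lambda>k. \<tau> k *\<^sub>R V k) \<longlonglongrightarrow> v)}"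

definition clarke_subdiff :: "('a::real_inner \<Rightarrow> ereal) \<Rightarrow> 'a \<Rightarrow> 'a set" where
  "clarke_subdiff f x = closure (convex hull (limiting_subdiff f x + horizon_subdiff f x))"

text \<open>
  The next two inequalities are the ones whose validity on a neighbourhood defines the exponents.
  In the first, the sublevel set contains \<open>x0\<close>, so that \<open>infdist\<close> is the usual distance. In the
  second, \<open>real_of_ereal\<close> is only applied to a number strictly between \<open>0\<close> and \<open>\<infinity>\<close> wherever the
  inequality is used.
\<close>

definition growth_ineq ::
  "('a::real_inner \<Rightarrow> ereal) \<Rightarrow> 'a \<Rightarrow> real \<Rightarrow> real \<Rightarrow> 'a \<Rightarrow> bool" where
  "growth_ineq f x0 \<kappa> \<beta> x \<longleftrightarrow>
     max (f x - f x0) 0 \<ge> ereal (\<kappa> * infdist x {y. f y \<le> f x0} powr \<beta>)"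

definition KL_ineq ::
  "('a::real_inner \<Rightarrow> ereal) \<Rightarrow> 'a \<Rightarrow> real \<Rightarrow> real \<Rightarrow> 'a \<Rightarrow> bool" where
  "KL_ineq f x0 c \<alpha> x \<longleftrightarrow>
     edist_set 0 (clarke_subdiff f x) \<ge> ereal (c * real_of_ereal (f x - f x0) powr \<alpha>)"

definition has_growth_exponent :: "('a::real_inner \<Rightarrow> ereal) \<Rightarrow> 'a \<Rightarrow> real \<Rightarrow> bool" where
  "has_growth_exponent f x0 \<beta> \<longleftrightarrow>
     x0 \<in> effective_domain f \<and> 1 \<le> \<beta> \<and>
     (\<exists>\<rho>>0. \<exists>\<kappa>>0. \<forall>x\<in>ball x0 \<rho>. growth_ineq f x0 \<kappa> \<beta> x)"

definition has_KL_exponent :: "('a::real_inner \<Rightarrow> ereal) \<Rightarrow> 'a \<Rightarrow> real \<Rightarrow> bool" where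
  "has_KL_exponent f x0 \<alpha> \<longleftrightarrow>
     x0 \<in> effective_domain f \<and> 0 \<le> \<alpha> \<and> \<alpha> < 1 \<and>
     (\<exists>r>0. \<exists>l>0. \<exists>c>0. \<forall>x\<in>ball x0 r.
        0 < f x - f x0 \<and> f x - f x0 < ereal l \<longrightarrow> KL_ineq f x0 c \<alpha> x)"

end

theory Submission
  imports Defs
begin

text \<open>
  Both inequalities are, up to constants, invariant under the diffeomorphisms \<open>act g\<close> as long as
  \<open>g\<close> stays near the identity. It therefore suffices to know them on a set that the group, using
  only such \<open>g\<close>, spreads over a full neighbourhood of \<open>x0\<close>. Transversality makes the affine space
  \<open>L + {x0}\<close> such a set.

  The spreading statement is \<open>action_reaches_transversal_slice\<close>. In a chart with parameter \<open>u\<close>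
  around the identity, \<open>(u, w) \<mapsto> u \<cdot> (x0 + w)\<close> with \<open>w \<in> L\<close> has at the base point the derivative
  \<open>(du, dw) \<mapsto> D du + dw\<close>, where the range of \<open>D\<close> is the tangent space of the orbit. This is onto by
  hypothesis, so the map is open at the base point: every \<open>x\<close> near \<open>x0\<close> is \<open>act g y\<close> with \<open>y\<close> in
  \<open>L + {x0}\<close> near \<open>x0\<close>. By continuity of the derivatives, all the \<open>g\<close> that occur satisfy one bound \<open>M\<close> on the
  derivative of \<open>act g\<close> near \<open>x0\<close>.

  Now let \<open>x = act g y\<close>. Invariance gives \<open>f x = f y\<close>, so only the other sides of the inequalities
  have to be compared. The sublevel set is invariant, and \<open>act g\<close> is \<open>M\<close>-Lipschitz, so the distance
  of \<open>x\<close> to it is at most \<open>M\<close> times that of \<open>y\<close> (\<open>infdist_image_le\<close>); this gives the growth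
  exponent. As \<open>f \<circ> act g = f\<close>, the chain rule \<open>clarke_subdiff_compose\<close> sends every Clarke
  subgradient of \<open>f\<close> at \<open>x\<close> to one at \<open>y\<close> by the adjoint of the derivative of \<open>act g\<close>, lengthening
  it at most by the factor \<open>M\<close>; this gives the Kurdyka-Lojasiewicz exponent.
\<close>

section \<open>Smooth maps\<close>

lemma smooth_on_has_derivative:
  assumes "smooth_on S f" "x \<in> S"
  shows "(f has_derivative frechet_derivative f (at x)) (at x)"
proof -
  have "Ck_on (Suc 0) S f" using assms(1) by (simp only: smooth_on_def)
  then show ?thesis using assms(2) by (simp add: frechet_derivative_works[symmetric])
qed

lemma smooth_on_continuous_directional_derivative:
  assumes "smooth_on S f"
  shows "continuous_on S (\<lambda>x. frechet_derivative f (at x) v)"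
proof -
  have "Ck_on (Suc 0) S f" using assms by (simp only: smooth_on_def)
  then show ?thesis by simp
qed

text \<open>
  Openness of \<open>S\<close> is what lets the derivatives, which are taken in the ambient space, depend only on
  the values on \<open>S\<close>.
\<close>

lemma Ck_on_cong:
  assumes "open S" "\<And>x. x \<in> S \<Longrightarrow> f x = g x"
  shows "Ck_on k S f \<Longrightarrow> Ck_on k S g"
  using assms(2)
proof (induction k arbitrary: f g)
  case 0
  then show ?case using continuous_on_cong[of S S f g] by simp
next
  case (Suc k)
  have d: "(g has_derivative frechet_derivative f (at x)) (at x)" if "x \<in> S" for x
  proof (rule has_derivative_transform_within_open[OF _ \<open>open S\<close> that])
    show "(f has_derivative frechet_derivative f (at x)) (at x)"
      using Suc.prems(1) that by (simp add: frechet_derivative_works[symmetric])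
  qed (use Suc.prems(2) in auto)
  have e: "frechet_derivative g (at x) = frechet_derivative f (at x)" if "x \<in> S" for x
    using frechet_derivative_at[OF d[OF that]] by simp
  have "Ck_on k S (\<lambda>x. frechet_derivative g (at x) v)" for v
  proof (rule Suc.IH)
    show "Ck_on k S (\<lambda>x. frechet_derivative f (at x) v)" using Suc.prems(1) by simp
  qed (simp add: e)
  moreover have "g differentiable (at x)" if "x \<in> S" for x
    using d[OF that] differentiableI by blast
  ultimately show ?case by simp
qed

lemma smooth_on_cong:
  assumes "open S" "\<And>x. x \<in> S \<Longrightarrow> f x = g x" "smooth_on S f"
  shows "smooth_on S g"
  using assms Ck_on_cong unfolding smooth_on_def by metis

lemma has_derivative_partial_snd:
  assumes "(F has_derivative D) (at (u, x))"
  shows "((\<lambda>y. F (u, y)) has_derivative (\<lambda>v. D (0, v))) (at x)"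
proof -
  have "((\<lambda>y. (u, y)) has_derivative (\<lambda>v. (0, v))) (at x)"
    by (auto intro!: derivative_eq_intros)
  from diff_chain_at[OF this assms] show ?thesis by (simp add: o_def)
qed

lemma has_derivative_partial_fst:
  assumes "(F has_derivative D) (at (u, x))"
  shows "((\<lambda>w. F (w, x)) has_derivative (\<lambda>v. D (v, 0))) (at u)"
proof -
  have "((\<lambda>w. (w, x)) has_derivative (\<lambda>v. (v, 0))) (at u)"
    by (auto intro!: derivative_eq_intros)
  from diff_chain_at[OF this assms] show ?thesis by (simp add: o_def)
qed

lemma linear_norm_le_sum_Basis:
  fixes D :: "'x::euclidean_space \<Rightarrow> 'y::real_normed_vector"
  assumes "linear D" "\<And>b. b \<in> Basis \<Longrightarrow> norm (D b) \<le> C"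
  shows "norm (D v) \<le> (real DIM('x) * C) * norm v"
proof -
  have "D v = D (\<Sum>b\<in>Basis. (v \<bullet> b) *\<^sub>R b)" by (simp add: euclidean_representation)
  also have "\<dots> = (\<Sum>b\<in>Basis. (v \<bullet> b) *\<^sub>R D b)"
    using assms(1) by (simp add: linear_sum linear_scale)
  also have "norm \<dots> \<le> (\<Sum>b\<in>(Basis::'x set). norm v * C)"
    by (intro sum_norm_le) (auto intro!: mult_mono assms(2) simp: Basis_le_norm)
  finally show ?thesis by (simp add: mult_ac)
qed

text \<open>
  The definition of smoothness only speaks of directional derivatives, one direction at a time.
  Since the second factor is finite-dimensional, bounding the finitely many basis directions near
  \<open>p\<close> gives an operator bound. This is the source of all the uniform constants: it makes the
  diffeomorphisms \<open>act g\<close> uniformly Lipschitz for \<open>g\<close> near the identity.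
\<close>

lemma smooth_on_partial_derivative_locally_bounded:
  fixes F :: "'a::real_normed_vector \<times> 'x::euclidean_space \<Rightarrow> 'y::real_normed_vector"
  assumes "smooth_on W F" "open W" "p \<in> W"
  obtains \<delta> M where "\<delta> > 0" "M > 0" "ball p \<delta> \<subseteq> W"
    "\<And>q v. q \<in> ball p \<delta> \<Longrightarrow> norm (frechet_derivative F (at q) (0, v)) \<le> M * norm v"
proof -
  define C where "C = Max ((\<lambda>b. norm (frechet_derivative F (at p) (0, b))) ` (Basis::'x set)) + 1"
  have "\<forall>b\<in>Basis. \<forall>\<^sub>F q in nhds p. norm (frechet_derivative F (at q) (0, b)) < C"
  proof
    fix b :: 'x assume b: "b \<in> Basis"
    have "norm (frechet_derivative F (at p) (0, b)) \<le> C - 1"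
      unfolding C_def using b by simp
    moreover have "(\<lambda>q. frechet_derivative F (at q) (0, b)) \<midarrow>p\<rightarrow> frechet_derivative F (at p) (0, b)"
      using smooth_on_continuous_directional_derivative[OF assms(1)] assms(2,3)
      by (simp add: continuous_on_eq_continuous_at isCont_def)
    then have "((\<lambda>q. norm (frechet_derivative F (at q) (0, b))) \<longlongrightarrow>
        norm (frechet_derivative F (at p) (0, b))) (nhds p)"
      by (intro tendsto_norm
          tendsto_at_iff_tendsto_nhds[where g="\<lambda>q. frechet_derivative F (at q) (0, b)", THEN iffD1])
    ultimately show "\<forall>\<^sub>F q in nhds p. norm (frechet_derivative F (at q) (0, b)) < C"
      by (intro order_tendstoD(2)[of _ "norm (frechet_derivative F (at p) (0, b))"]) auto
  qed
  then have "\<forall>\<^sub>F q in nhds p. \<forall>b\<in>Basis. norm (frechet_derivative F (at q) (0, b)) < C"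
    by (simp add: eventually_ball_finite_distrib)
  moreover have "\<forall>\<^sub>F q in nhds p. q \<in> W"
    using assms(2,3) by (simp add: eventually_nhds_in_open)
  ultimately have "\<forall>\<^sub>F q in nhds p. q \<in> W \<and> (\<forall>b\<in>Basis. norm (frechet_derivative F (at q) (0, b)) < C)"
    by eventually_elim auto
  then obtain \<delta> where \<delta>: "\<delta> > 0"
    "\<And>q. q \<in> ball p \<delta> \<Longrightarrow> q \<in> W \<and> (\<forall>b\<in>Basis. norm (frechet_derivative F (at q) (0, b)) < C)"
    unfolding eventually_nhds_metric by (auto simp: dist_commute)
  have C: "C > 0"
  proof -
    obtain b :: 'x where "b \<in> Basis" using nonempty_Basis by blast
    moreover have "p \<in> ball p \<delta>" using \<delta>(1) by simp
    ultimately have "norm (frechet_derivative F (at p) (0, b)) < C" using \<delta>(2) by blast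
    then show ?thesis using norm_ge_zero by (rule le_less_trans[rotated])
  qed
  show ?thesis
  proof (rule that[of \<delta> "real DIM('x) * C"])
    show "real DIM('x) * C > 0" using C by simp
    fix q and v :: 'x assume q: "q \<in> ball p \<delta>"
    have "((\<lambda>y. F (fst q, y)) has_derivative (\<lambda>v. frechet_derivative F (at q) (0, v))) (at (snd q))"
      using \<delta>(2)[OF q] smooth_on_has_derivative[OF assms(1)]
      by (intro has_derivative_partial_snd) simp
    then have "linear (\<lambda>v. frechet_derivative F (at q) (0, v))"
      by (rule has_derivative_linear)
    then show "norm (frechet_derivative F (at q) (0, v)) \<le> real DIM('x) * C * norm v"
      using \<delta>(2)[OF q] by (intro linear_norm_le_sum_Basis) (auto intro: less_imp_le)
  qed (use \<delta> in auto)
qed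

section \<open>Subdifferentials under a change of variables\<close>

text \<open>
  Substituting \<open>w = h z\<close> in the inequality that defines a regular subgradient \<open>v\<close> at \<open>h y\<close> and
  expanding \<open>h z\<close> to first order moves \<open>D\<close> to the other side of the inner product. Both the Taylor
  remainder of \<open>h\<close> and the old error term are \<open>o(|z - y|)\<close>.
\<close>

lemma regular_subdiff_compose:
  fixes h :: "'a::euclidean_space \<Rightarrow> 'b::euclidean_space"
  assumes h: "(h has_derivative D) (at y)" and v: "v \<in> regular_subdiff f (h y)"
  shows "adjoint D v \<in> regular_subdiff (f \<circ> h) y"
proof -
  obtain e where dom: "h y \<in> effective_domain f"
    and e: "e \<in> o[at (h y)](\<lambda>w. norm (w - h y))"
    and sub: "\<forall>\<^sub>F w in at (h y). f w \<ge> f (h y) + ereal (v \<bullet> (w - h y) + e w)"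
    using v unfolding regular_subdiff_def by blast
  have bl: "bounded_linear D" by (rule has_derivative_bounded_linear[OF h])
  then have lin: "linear D" by (rule bounded_linear.linear)
  (* The old error term e is only controlled away from h y, so its value at h y is discarded. *)
  define e' where
    "e' z = v \<bullet> (h z - h y - D (z - y)) + (if h z = h y then 0 else e (h z))" for z
  have cont: "filterlim h (nhds (h y)) (at y)"
    using has_derivative_continuous[OF h] by (simp add: isCont_def)
  have pull: "\<forall>\<^sub>F z in at y. h z \<noteq> h y \<longrightarrow> P (h z)" if "\<forall>\<^sub>F w in at (h y). P w" for P
    using cont that unfolding eventually_at_filter[of _ "h y"] filterlim_iff by auto
  have rem: "\<forall>\<^sub>F z in at y. norm (h z - h y - D (z - y)) \<le> c * norm (z - y)" if "c > 0" for c
    using h that unfolding has_derivative_within_alt2 by blast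
  obtain K where K: "K > 0" "\<And>z. norm (D z) \<le> norm z * K"
    using bounded_linear.pos_bounded[OF bl] by auto
  have "e' \<in> o[at y](\<lambda>z. norm (z - y))"
  proof (rule landau_o.smallI)
    fix c :: real assume "c > 0"
    (* Each of the two summands of e' is to contribute c / 2; the bound on |h z - h y| by
       (K + 1) |z - y| costs the factor K + 1 in the second. *)
    define c1 where "c1 = c / (2 * (norm v + 1))"
    define c2 where "c2 = c / (2 * (K + 1))"
    have c12: "c1 > 0" "c2 > 0" using \<open>c > 0\<close> K
      by (auto simp: c1_def c2_def intro!: divide_pos_pos mult_pos_pos add_nonneg_pos)
    show "\<forall>\<^sub>F z in at y. norm (e' z) \<le> c * norm (norm (z - y))"
      using rem[OF c12(1)] rem[OF zero_less_one] pull[OF landau_o.smallD[OF e c12(2)]]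
    proof eventually_elim
      case (elim z)
      have "norm (h z - h y) \<le> norm (h z - h y - D (z - y)) + norm (D (z - y))"
        using norm_triangle_ineq[of "h z - h y - D (z - y)" "D (z - y)"] by simp
      also have "\<dots> \<le> (K + 1) * norm (z - y)"
        using elim(2) K(2)[of "z - y"] by (simp add: algebra_simps)
      finally have hz: "norm (h z - h y) \<le> (K + 1) * norm (z - y)" .
      have "\<bar>v \<bullet> (h z - h y - D (z - y))\<bar> \<le> norm v * norm (h z - h y - D (z - y))"
        by (rule Cauchy_Schwarz_ineq2)
      also have "\<dots> \<le> (norm v + 1) * (c1 * norm (z - y))"
        by (intro mult_mono elim) auto
      also have "\<dots> = c / 2 * norm (z - y)"
        using norm_ge_zero[of v] by (simp add: c1_def field_simps del: norm_ge_zero)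
      finally have 1: "\<bar>v \<bullet> (h z - h y - D (z - y))\<bar> \<le> c / 2 * norm (z - y)" .
      have 2: "\<bar>if h z = h y then 0 else e (h z)\<bar> \<le> c / 2 * norm (z - y)"
      proof (cases "h z = h y")
        case True then show ?thesis using \<open>c > 0\<close> by simp
      next
        case False
        then have "\<bar>e (h z)\<bar> \<le> c2 * norm (h z - h y)" using elim(3) by simp
        also have "\<dots> \<le> c2 * ((K + 1) * norm (z - y))"
          using hz c12(2) by (intro mult_left_mono) auto
        also have "\<dots> = c / 2 * norm (z - y)"
          using K(1) by (simp add: c2_def field_simps)
        finally show ?thesis using False by simp
      qed
      show ?case using 1 2 by (simp add: e'_def)
    qed
  qed
  moreover have "\<forall>\<^sub>F z in at y. (f \<circ> h) z \<ge> (f \<circ> h) y + ereal (adjoint D v \<bullet> (z - y) + e' z)"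
    using pull[OF sub]
  proof eventually_elim
    case (elim z)
    have "adjoint D v \<bullet> (z - y) = v \<bullet> D (z - y)"
      by (metis adjoint_works[OF lin] inner_commute)
    then have "adjoint D v \<bullet> (z - y) + e' z =
        v \<bullet> (h z - h y) + (if h z = h y then 0 else e (h z))"
      by (simp add: e'_def inner_diff_right)
    then show ?case using elim by (cases "h z = h y") (auto simp flip: zero_ereal_def)
  qed
  ultimately show ?thesis
    using dom unfolding regular_subdiff_def effective_domain_def by auto
qed

lemma tendsto_adjoint_apply:
  fixes D :: "'c \<Rightarrow> 'a::euclidean_space \<Rightarrow> 'b::euclidean_space"
  assumes "\<And>z. linear (D z)" "linear E" "\<And>w. ((\<lambda>z. D z w) \<longlongrightarrow> E w) F" "(V \<longlongrightarrow> v) F"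
  shows "((\<lambda>z. adjoint (D z) (V z)) \<longlongrightarrow> adjoint E v) F"
proof (subst tendsto_componentwise_iff, intro ballI)
  fix b :: 'a
  have "adjoint (D z) (V z) \<bullet> b = V z \<bullet> D z b" for z
    by (metis adjoint_works[OF assms(1)] inner_commute)
  moreover have "adjoint E v \<bullet> b = v \<bullet> E b"
    by (metis adjoint_works[OF assms(2)] inner_commute)
  moreover have "((\<lambda>z. V z \<bullet> D z b) \<longlongrightarrow> v \<bullet> E b) F"
    by (intro tendsto_inner assms)
  ultimately show "((\<lambda>z. adjoint (D z) (V z) \<bullet> b) \<longlongrightarrow> adjoint E v \<bullet> b) F" by simp
qed

text \<open>
  The limiting and horizon subdifferentials collect limits of regular subgradients at points
  \<open>X j\<close> near \<open>h y\<close>. Being a homeomorphism, \<open>h\<close> turns these points into points \<open>k (X j)\<close> near \<open>y\<close>,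
  and continuity of the derivative lets the adjoints taken there converge to the one at \<open>y\<close>. The
  closed convex hull is then respected because the adjoint at \<open>y\<close> is a single linear map.
\<close>

lemma clarke_subdiff_compose:
  fixes h :: "'a::euclidean_space \<Rightarrow> 'b::euclidean_space"
  assumes D: "\<And>z. (h has_derivative D z) (at z)"
    and Dcont: "\<And>w. continuous_on UNIV (\<lambda>z. D z w)"
    and hom: "homeomorphism UNIV UNIV h k"
  shows "adjoint (D y) ` clarke_subdiff f (h y) \<subseteq> clarke_subdiff (f \<circ> h) y"
proof -
  let ?B = "adjoint (D y)"
  have lin: "linear (D z)" for z by (rule has_derivative_linear[OF D])
  have linB: "linear ?B" by (rule adjoint_linear[OF lin])
  have hk: "h (k x) = x" "k (h z) = z" for x z using hom by (auto simp: homeomorphism_def)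
  have kX: "(\<lambda>j. k (X j)) \<longlonglongrightarrow> y" if "X \<longlonglongrightarrow> h y" for X :: "nat \<Rightarrow> 'b"
  proof -
    have "isCont k (h y)"
      using hom by (simp add: homeomorphism_def continuous_on_eq_continuous_at)
    from isCont_tendsto_compose[OF this that] show ?thesis by (simp add: hk)
  qed
  have reg: "adjoint (D (k x)) v \<in> regular_subdiff (f \<circ> h) (k x)" if "v \<in> regular_subdiff f x" for x v
    using regular_subdiff_compose[OF D, of v f "k x"] that by (simp add: hk)
  have lim: "(\<lambda>j. adjoint (D (k (X j))) (V j)) \<longlonglongrightarrow> ?B v"
    if "X \<longlonglongrightarrow> h y" "V \<longlonglongrightarrow> v" for X V v
  proof (intro tendsto_adjoint_apply lin that)
    fix w
    have "isCont (\<lambda>z. D z w) y" using Dcont by (simp add: continuous_on_eq_continuous_at)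
    from isCont_tendsto_compose[OF this kX[OF that(1)]]
    show "(\<lambda>j. D (k (X j)) w) \<longlonglongrightarrow> D y w" .
  qed
  have 1: "?B ` limiting_subdiff f (h y) \<subseteq> limiting_subdiff (f \<circ> h) y"
  proof
    fix w assume "w \<in> ?B ` limiting_subdiff f (h y)"
    then obtain v X V where w: "w = ?B v" and dom: "h y \<in> effective_domain f"
      and V: "\<And>j::nat. V j \<in> regular_subdiff f (X j)"
      and X: "X \<longlonglongrightarrow> h y" "(\<lambda>j. f (X j)) \<longlonglongrightarrow> f (h y)" "V \<longlonglongrightarrow> v"
      unfolding limiting_subdiff_def by blast
    have "\<forall>j. adjoint (D (k (X j))) (V j) \<in> regular_subdiff (f \<circ> h) (k (X j))" using V reg by blast
    moreover have "(\<lambda>j. (f \<circ> h) (k (X j))) \<longlonglongrightarrow> (f \<circ> h) y" using X by (simp add: hk)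
    moreover have "y \<in> effective_domain (f \<circ> h)" using dom by (simp add: effective_domain_def)
    ultimately show "w \<in> limiting_subdiff (f \<circ> h) y"
      unfolding limiting_subdiff_def w using kX[OF X(1)] lim[OF X(1,3)]
      by (intro CollectI conjI exI[of _ "\<lambda>j. k (X j)"]
          exI[of _ "\<lambda>j. adjoint (D (k (X j))) (V j)"]) auto
  qed
  have 2: "?B ` horizon_subdiff f (h y) \<subseteq> horizon_subdiff (f \<circ> h) y"
  proof
    fix w assume "w \<in> ?B ` horizon_subdiff f (h y)"
    then obtain v X V \<tau> where w: "w = ?B v" and dom: "h y \<in> effective_domain f"
      and V: "\<And>j::nat. V j \<in> regular_subdiff f (X j)"
      and \<tau>: "\<forall>j. 0 < \<tau> j" "decseq \<tau>" "\<tau> \<longlonglongrightarrow> (0::real)"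
      and X: "X \<longlonglongrightarrow> h y" "(\<lambda>j. f (X j)) \<longlonglongrightarrow> f (h y)" "(\<lambda>j. \<tau> j *\<^sub>R V j) \<longlonglongrightarrow> v"
      unfolding horizon_subdiff_def by blast
    have "\<forall>j. adjoint (D (k (X j))) (V j) \<in> regular_subdiff (f \<circ> h) (k (X j))" using V reg by blast
    moreover have "(\<lambda>j. (f \<circ> h) (k (X j))) \<longlonglongrightarrow> (f \<circ> h) y" using X by (simp add: hk)
    moreover have "y \<in> effective_domain (f \<circ> h)" using dom by (simp add: effective_domain_def)
    moreover have "(\<lambda>j. \<tau> j *\<^sub>R adjoint (D (k (X j))) (V j)) \<longlonglongrightarrow> ?B v"
      using lim[OF X(1,3)] by (simp add: linear_scale[OF adjoint_linear[OF lin]])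
    ultimately show "w \<in> horizon_subdiff (f \<circ> h) y"
      unfolding horizon_subdiff_def w using kX[OF X(1)] \<tau>
      by (intro CollectI conjI exI[of _ "\<lambda>j. k (X j)"]
          exI[of _ "\<lambda>j. adjoint (D (k (X j))) (V j)"] exI[of _ \<tau>]) auto
  qed
  have "?B ` (limiting_subdiff f (h y) + horizon_subdiff f (h y)) \<subseteq>
      limiting_subdiff (f \<circ> h) y + horizon_subdiff (f \<circ> h) y"
    using 1 2 by (fastforce simp: set_plus_def linear_add[OF linB])
  then have "?B ` (convex hull (limiting_subdiff f (h y) + horizon_subdiff f (h y))) \<subseteq>
      convex hull (limiting_subdiff (f \<circ> h) y + horizon_subdiff (f \<circ> h) y)"
    by (simp add: convex_hull_linear_image[OF linB] hull_mono)
  moreover have "bounded_linear ?B" using linB by (simp add: linear_conv_bounded_linear)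
  ultimately show ?thesis
    unfolding clarke_subdiff_def
    by (meson closure_bounded_linear_image_subset closure_mono subset_trans)
qed

lemma norm_adjoint_le:
  fixes D :: "'a::euclidean_space \<Rightarrow> 'b::euclidean_space"
  assumes "linear D" "\<And>w. norm (D w) \<le> M * norm w"
  shows "norm (adjoint D v) \<le> M * norm v"
proof (cases "adjoint D v = 0")
  case True
  obtain b :: 'a where "b \<in> Basis" using nonempty_Basis by blast
  then have "0 \<le> M" using order_trans[OF norm_ge_zero assms(2)[of b]] by simp
  then show ?thesis using True by simp
next
  case False
  have "norm (adjoint D v) * norm (adjoint D v) = v \<bullet> D (adjoint D v)"
    using adjoint_works[OF assms(1), of "adjoint D v" v]
    by (simp add: inner_commute power2_norm_eq_inner flip: power2_eq_square)
  also have "\<dots> \<le> norm v * (M * norm (adjoint D v))"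
    by (rule order_trans[OF norm_cauchy_schwarz]) (intro mult_left_mono assms norm_ge_zero)
  finally have "norm (adjoint D v) * norm (adjoint D v) \<le> (M * norm v) * norm (adjoint D v)"
    by (simp add: mult_ac)
  then show ?thesis using False by simp
qed
section \<open>The action near the identity\<close>

context smooth_action
begin

lemma
  assumes "(U, \<phi>) \<in> A"
  shows chart_openin: "openin T U" and chart_subset_carrier: "U \<subseteq> carrier G"
    and chart_image_open: "open (\<phi> ` U)" and chart_inj_on: "inj_on \<phi> U"
    and chart_homeomorphic: "homeomorphic_map (subtopology T U) (top_of_set (\<phi> ` U)) \<phi>"
proof -
  have m: "openin T U \<and> open (\<phi> ` U) \<and>
      homeomorphic_map (subtopology T U) (top_of_set (\<phi> ` U)) \<phi>"
    using manifold assms unfolding smooth_manifold_def by blast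
  then show "openin T U" "open (\<phi> ` U)"
    "homeomorphic_map (subtopology T U) (top_of_set (\<phi> ` U)) \<phi>" by auto
  then show "U \<subseteq> carrier G" using openin_subset topspace_eq by metis
  then show "inj_on \<phi> U"
    using homeomorphic_imp_injective_map[OF conjunct2[OF conjunct2[OF m]]] topspace_eq
    by (simp add: Int_absorb1)
qed

lemma chart_overlap_image_open:
  assumes "(U, \<phi>) \<in> A" "(V, \<psi>) \<in> A"
  shows "open (\<phi> ` (U \<inter> V))"
proof -
  have "openin (subtopology T U) (U \<inter> V)"
    using chart_openin[OF assms(2)] openin_subtopology_Int2 by blast
  then have "openin (top_of_set (\<phi> ` U)) (\<phi> ` (U \<inter> V))"
    using chart_homeomorphic[OF assms(1)] homeomorphic_imp_open_map open_map_def by metis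
  then show ?thesis using chart_image_open[OF assms(1)] openin_open_trans by blast
qed

lemma ex_chart_around:
  assumes "g \<in> carrier G"
  obtains U \<phi> where "(U, \<phi>) \<in> A" "g \<in> U"
  using manifold assms topspace_eq unfolding smooth_manifold_def by auto

text \<open>
  A chart \<open>\<phi>\<close> turns the action into an honest smooth map between open subsets of normed spaces. All
  that follows is read off from this local expression.
\<close>

lemma action_smooth_in_chart:
  assumes "(U, \<phi>) \<in> A"
  shows "smooth_on (\<phi> ` U \<times> UNIV) (\<lambda>(u, x). act (inv_into U \<phi> u) x)"
proof -
  have inj: "inj_on \<phi> U" by (rule chart_inj_on[OF assms])
  have pa: "(U \<times> UNIV, map_prod \<phi> id) \<in> prod_atlas A std_atlas"
    using assms unfolding prod_atlas_def std_atlas_def by blast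
  have "smooth_on (map_prod \<phi> id ` {p \<in> U \<times> UNIV. (\<lambda>(g, x). act g x) p \<in> UNIV})
      (id \<circ> (\<lambda>(g, x). act g x) \<circ> inv_into (U \<times> UNIV) (map_prod \<phi> id))"
    using smooth_act pa unfolding smooth_map_def std_atlas_def by blast
  moreover have "map_prod \<phi> id ` {p \<in> U \<times> UNIV. (\<lambda>(g, x). act g x) p \<in> UNIV} = \<phi> ` U \<times> UNIV"
    by (auto simp: image_iff)
  ultimately have "smooth_on (\<phi> ` U \<times> UNIV)
      (id \<circ> (\<lambda>(g, x). act g x) \<circ> inv_into (U \<times> UNIV) (map_prod \<phi> id))" by simp
  then show ?thesis
  proof (rule smooth_on_cong[rotated 2])
    show "open (\<phi> ` U \<times> (UNIV :: 'x set))"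
      by (intro open_Times chart_image_open[OF assms] open_UNIV)
    fix p :: "'m \<times> 'x" assume "p \<in> \<phi> ` U \<times> UNIV"
    then obtain g x where p: "p = (\<phi> g, x)" "g \<in> U" by auto
    have "inv_into (U \<times> UNIV) (map_prod \<phi> id) p = (g, x)"
      by (rule inv_into_f_eq) (use p inj in \<open>auto intro: map_prod_inj_on\<close>)
    then show "(id \<circ> (\<lambda>(g, x). act g x) \<circ> inv_into (U \<times> UNIV) (map_prod \<phi> id)) p =
        (case p of (u, x) \<Rightarrow> act (inv_into U \<phi> u) x)"
      using p inj by simp
  qed
qed

lemma action_has_derivative_in_chart:
  assumes "(U, \<phi>) \<in> A" "u \<in> \<phi> ` U"
  shows "(act (inv_into U \<phi> u) has_derivative
      (\<lambda>v. frechet_derivative (\<lambda>(u, x). act (inv_into U \<phi> u) x) (at (u, x)) (0, v))) (at x)"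
  using has_derivative_partial_snd[OF smooth_on_has_derivative[OF
        action_smooth_in_chart[OF assms(1)]], of u x] assms(2)
  by simp

lemma act_C1:
  assumes "g \<in> carrier G"
  shows "(act g has_derivative frechet_derivative (act g) (at x)) (at x)"
    and "continuous_on UNIV (\<lambda>x. frechet_derivative (act g) (at x) v)"
proof -
  obtain U \<phi> where c: "(U, \<phi>) \<in> A" "g \<in> U" using ex_chart_around[OF assms] .
  have g: "inv_into U \<phi> (\<phi> g) = g" using chart_inj_on[OF c(1)] c(2) by simp
  let ?F = "\<lambda>(u, x). act (inv_into U \<phi> u) x"
  have d: "(act g has_derivative (\<lambda>v. frechet_derivative ?F (at (\<phi> g, x)) (0, v))) (at x)" for x
    using action_has_derivative_in_chart[OF c(1), of "\<phi> g" x] c(2) g by simp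
  have e: "frechet_derivative (act g) (at x) = (\<lambda>v. frechet_derivative ?F (at (\<phi> g, x)) (0, v))" for x
    using frechet_derivative_at[OF d] by simp
  show "(act g has_derivative frechet_derivative (act g) (at x)) (at x)"
    using d e by simp
  have "continuous_on UNIV (\<lambda>x. frechet_derivative ?F (at (\<phi> g, x)) (0, v))"
    by (rule continuous_on_compose2[OF smooth_on_continuous_directional_derivative[OF
            action_smooth_in_chart[OF c(1)]], of _ "\<lambda>x. (\<phi> g, x)"])
      (use c(2) in \<open>auto intro!: continuous_intros\<close>)
  then show "continuous_on UNIV (\<lambda>x. frechet_derivative (act g) (at x) v)" by (simp add: e)
qed

lemma act_one: "act \<one> x = x"
  using fun_cong[OF id_eq_one, of x] by simp

lemma act_inv_act: "g \<in> carrier G \<Longrightarrow> act (inv g) (act g x) = x"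
  using orbit_sym_aux by blast

lemma act_homeomorphism:
  assumes "g \<in> carrier G"
  shows "homeomorphism UNIV UNIV (act g) (act (inv g))"
proof -
  have c: "continuous_on UNIV (act h)" if "h \<in> carrier G" for h
    using act_C1(1)[OF that] has_derivative_continuous continuous_at_imp_continuous_on by blast
  have "act g (act (inv g) x) = x" for x
    using act_inv_act[of "inv g"] assms by simp
  then show ?thesis
    using act_inv_act[OF assms] by (intro homeomorphismI c assms inv_closed) auto
qed

text \<open>
  The chain rule for the transition map between the two charts. Exchanging the charts gives
  equality, so that the union over charts in the definition of the tangent space is the image in
  any single chart; transversality can therefore be used in one chart.
\<close>

lemma orbit_map_tangent_subset:
  assumes "(U, \<phi>) \<in> A" "\<one> \<in> U" "(V, \<psi>) \<in> A" "\<one> \<in> V"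
  shows "range (frechet_derivative (\<lambda>u. act (inv_into U \<phi> u) x) (at (\<phi> \<one>))) \<subseteq>
    range (frechet_derivative (\<lambda>u. act (inv_into V \<psi> u) x) (at (\<psi> \<one>)))"
proof -
  let ?a = "\<lambda>u. act (inv_into U \<phi> u) x" and ?b = "\<lambda>u. act (inv_into V \<psi> u) x"
  let ?t = "\<psi> \<circ> inv_into U \<phi>"
  have U1: "inv_into U \<phi> (\<phi> \<one>) = \<one>" using chart_inj_on[OF assms(1)] assms(2) by simp
  have mem: "\<phi> \<one> \<in> \<phi> ` (U \<inter> V)" using assms by blast
  have "smooth_on (\<phi> ` (U \<inter> V)) ?t"
    using manifold assms(1,3) unfolding smooth_manifold_def by blast
  from smooth_on_has_derivative[OF this mem]
  have t: "(?t has_derivative frechet_derivative ?t (at (\<phi> \<one>))) (at (\<phi> \<one>))" .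
  have "(?b has_derivative (\<lambda>v. frechet_derivative (\<lambda>(u, x). act (inv_into V \<psi> u) x)
      (at (\<psi> \<one>, x)) (v, 0))) (at (\<psi> \<one>))"
    using has_derivative_partial_fst[OF smooth_on_has_derivative[OF
          action_smooth_in_chart[OF assms(3)]], of "\<psi> \<one>" x] assms(4) by simp
  then have "(?b has_derivative frechet_derivative ?b (at (\<psi> \<one>))) (at (\<psi> \<one>))"
    using frechet_derivative_at by metis
  then have "(?b has_derivative frechet_derivative ?b (at (\<psi> \<one>))) (at (?t (\<phi> \<one>)))"
    using U1 by simp
  from diff_chain_at[OF t this]
  have "(?b \<circ> ?t has_derivative frechet_derivative ?b (at (\<psi> \<one>)) \<circ> frechet_derivative ?t (at (\<phi> \<one>)))
      (at (\<phi> \<one>))" .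
  then have "(?a has_derivative frechet_derivative ?b (at (\<psi> \<one>)) \<circ> frechet_derivative ?t (at (\<phi> \<one>)))
      (at (\<phi> \<one>))"
  proof (rule has_derivative_transform_within_open[OF _ chart_overlap_image_open[OF assms(1,3)] mem])
    fix u assume "u \<in> \<phi> ` (U \<inter> V)"
    then show "(?b \<circ> ?t) u = ?a u"
      using chart_inj_on[OF assms(1)] chart_inj_on[OF assms(3)] by auto
  qed
  from frechet_derivative_at[OF this, symmetric] show ?thesis by auto
qed

lemma orbit_tangent_space_in_chart:
  assumes "(U, \<phi>) \<in> A" "\<one> \<in> U"
  shows "orbit_tangent_space G A act x =
    range (frechet_derivative (\<lambda>u. act (inv_into U \<phi> u) x) (at (\<phi> \<one>)))"
  using orbit_map_tangent_subset[OF _ _ assms] assms unfolding orbit_tangent_space_def by fast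

end

text \<open>
  Transversality says that \<open>(u, w) \<mapsto> D u + w\<close> maps \<open>'m \<times> L\<close> onto the whole space; splitting each
  basis vector in this way yields a linear right inverse \<open>t \<mapsto> (R t, Q t)\<close>.
\<close>

lemma transversal_right_inverse:
  fixes D :: "'m::real_normed_vector \<Rightarrow> 'x::euclidean_space"
  assumes "linear D" "subspace L" "range D + L = UNIV"
  obtains R Q where "bounded_linear R" "bounded_linear Q" "range Q \<subseteq> L" "\<And>t. D (R t) + Q t = t"
proof -
  have "\<forall>b. \<exists>u w. w \<in> L \<and> D u + w = b"
    using assms(3) by (metis UNIV_I rangeE set_plus_elim)
  then obtain r q where rq: "\<And>b. q b \<in> L" "\<And>b. D (r b) + q b = b" by metis
  define R where "R t = (\<Sum>b\<in>Basis. (t \<bullet> b) *\<^sub>R r b)" for t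
  define Q where "Q t = (\<Sum>b\<in>Basis. (t \<bullet> b) *\<^sub>R q b)" for t
  show ?thesis
  proof
    show "bounded_linear R" unfolding R_def
      by (intro bounded_linear_sum bounded_linear_scaleR_const bounded_linear_inner_left)
    show "bounded_linear Q" unfolding Q_def
      by (intro bounded_linear_sum bounded_linear_scaleR_const bounded_linear_inner_left)
    show "range Q \<subseteq> L"
      unfolding Q_def using assms(2) rq(1) by (auto intro!: subspace_sum subspace_scale)
    fix t
    have "D (R t) + Q t = (\<Sum>b\<in>Basis. (t \<bullet> b) *\<^sub>R (D (r b) + q b))"
      unfolding R_def Q_def
      by (simp add: linear_sum[OF assms(1)] linear_scale[OF assms(1)] sum.distrib scaleR_right_distrib)
    then show "D (R t) + Q t = t" by (simp add: rq(2) euclidean_representation)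
  qed
qed

text \<open>
  The partial derivative in the space variable is the identity because the neutral element acts
  trivially.
\<close>

lemma (in smooth_action) action_derivative_at_identity:
  assumes c: "(U, \<phi>) \<in> A" "\<one> \<in> U"
  shows "((\<lambda>(u, x). act (inv_into U \<phi> u) x) has_derivative
    (\<lambda>(du, dx). frechet_derivative (\<lambda>u. act (inv_into U \<phi> u) x0) (at (\<phi> \<one>)) du + dx))
    (at (\<phi> \<one>, x0))"
proof -
  let ?F = "\<lambda>(u, x). act (inv_into U \<phi> u) x"
  let ?D = "frechet_derivative ?F (at (\<phi> \<one>, x0))"
  have mem: "(\<phi> \<one>, x0) \<in> \<phi> ` U \<times> UNIV" using c by auto
  note F = smooth_on_has_derivative[OF action_smooth_in_chart[OF c(1)] mem]
  have "((\<lambda>u. act (inv_into U \<phi> u) x0) has_derivative (\<lambda>v. ?D (v, 0))) (at (\<phi> \<one>))"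
    using has_derivative_partial_fst[OF F] by simp
  from frechet_derivative_at[OF this]
  have 1: "frechet_derivative (\<lambda>u. act (inv_into U \<phi> u) x0) (at (\<phi> \<one>)) = (\<lambda>v. ?D (v, 0))" by simp
  have "inv_into U \<phi> (\<phi> \<one>) = \<one>" using chart_inj_on[OF c(1)] c(2) by simp
  then have "((\<lambda>x. x) has_derivative (\<lambda>v. ?D (0, v))) (at x0)"
    using has_derivative_partial_snd[OF F] by (simp add: act_one)
  from has_derivative_unique[OF this has_derivative_ident]
  have 2: "?D (0, v) = v" for v by metis
  have 3: "?D (du, 0) + dx = ?D (du, dx)" for du dx
    using linear_add[OF has_derivative_linear[OF F], of "(du, 0)" "(0, dx)"] by (simp add: 2)
  have "(\<lambda>(du, dx). frechet_derivative (\<lambda>u. act (inv_into U \<phi> u) x0) (at (\<phi> \<one>)) du + dx) = ?D"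
    unfolding 1 by (rule ext) (simp only: split_paired_all prod.case 3)
  then show ?thesis using F by (simp only:)
qed

text \<open>
  The geometric core: every point near \<open>x0\<close> is carried by a group element near the identity from a
  point of the affine space \<open>L + {x0}\<close> near \<open>x0\<close>. Composing the local action map \<open>F\<close> with the
  affine map \<open>t \<mapsto> (u0 + R t, x0 + Q t)\<close>, whose second component stays in \<open>L + {x0}\<close>, gives a map
  with derivative the identity at \<open>0\<close>, and such a map sends neighbourhoods of \<open>0\<close> to
  neighbourhoods of \<open>x0\<close>. The constants \<open>M\<close> and \<open>\<delta>\<close> of the derivative bound precede \<open>\<epsilon>\<close>, so that
  the slice point may be required to lie as close to \<open>x0\<close> as these constants demand.
\<close>

lemma action_reaches_transversal_slice:
  fixes act :: "'g \<Rightarrow> 'x::euclidean_space \<Rightarrow> 'x"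
  assumes "smooth_action G T A act" "subspace L" "orbit_tangent_space G A act x0 + L = UNIV"
  obtains M \<delta> where "M > 0" "\<delta> > 0"
    "\<And>\<epsilon>. \<epsilon> > 0 \<Longrightarrow> \<exists>\<eta>>0. \<forall>x\<in>ball x0 \<eta>. \<exists>g\<in>carrier G. \<exists>y \<in> ball x0 \<epsilon> \<inter> (L + {x0}).
       x = act g y \<and>
       (\<forall>z\<in>ball x0 \<delta>. \<forall>v. norm (frechet_derivative (act g) (at z) v) \<le> M * norm v)"
proof -
  interpret smooth_action G T A act by fact
  obtain U \<phi> where c: "(U, \<phi>) \<in> A" "\<one>\<^bsub>G\<^esub> \<in> U" using ex_chart_around[OF one_closed] .
  define F where "F = (\<lambda>(u, x). act (inv_into U \<phi> u) x)"
  define u0 where "u0 = \<phi> \<one>\<^bsub>G\<^esub>"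
  define D where "D = frechet_derivative (\<lambda>u. act (inv_into U \<phi> u) x0) (at u0)"
  define W where "W = \<phi> ` U \<times> (UNIV :: 'x set)"
  have smooth: "smooth_on W F" unfolding W_def F_def by (rule action_smooth_in_chart[OF c(1)])
  have W: "open W" "(u0, x0) \<in> W"
    unfolding W_def u0_def using c chart_image_open[OF c(1)] by (auto intro: open_Times)
  have F: "(F has_derivative (\<lambda>(du, dx). D du + dx)) (at (u0, x0))"
    unfolding F_def D_def u0_def by (rule action_derivative_at_identity[OF c])
  have "linear D"
    using has_derivative_linear[OF has_derivative_partial_fst[OF F]] by simp
  moreover have "range D + L = UNIV"
    using assms(3) orbit_tangent_space_in_chart[OF c, of x0] by (simp add: D_def u0_def)
  ultimately obtain R Q where RQ: "bounded_linear R" "bounded_linear Q" "range Q \<subseteq> L"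
    "\<And>t. D (R t) + Q t = t"
    using transversal_right_inverse assms(2) by metis
  obtain d M where dM: "d > 0" "M > 0" "ball (u0, x0) d \<subseteq> W"
    "\<And>q v. q \<in> ball (u0, x0) d \<Longrightarrow> norm (frechet_derivative F (at q) (0, v)) \<le> M * norm v"
    using smooth_on_partial_derivative_locally_bounded[OF smooth W] by metis
  define p where "p t = (u0 + R t, x0 + Q t)" for t
  have p0: "p 0 = (u0, x0)" unfolding p_def using RQ(1,2) by (simp add: linear_simps)
  have pd: "(p has_derivative (\<lambda>t. (R t, Q t))) (at t)" for t
    unfolding p_def using RQ(1,2)
    by (auto intro!: derivative_eq_intros bounded_linear_imp_has_derivative)
  then have pc: "continuous_on UNIV p"
    using has_derivative_continuous continuous_at_imp_continuous_on by blast
  have Fp: "((F \<circ> p) has_derivative id) (at 0)"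
  proof -
    have "(F \<circ> p has_derivative (\<lambda>(du, dx). D du + dx) \<circ> (\<lambda>t. (R t, Q t))) (at 0)"
      by (rule diff_chain_at[OF pd]) (simp add: p0 F)
    then show ?thesis by (simp add: o_def RQ(4) id_def)
  qed
  have F0: "F (u0, x0) = x0"
    unfolding F_def u0_def using chart_inj_on[OF c(1)] c(2) by (simp add: act_one)
  show ?thesis
  proof
    (* Half the radius d for the group parameter and half for the point: together their pair stays
       in the ball of radius d where the derivative is bounded. *)
    show "M > 0" "d / 2 > 0" using dM by auto
    fix \<epsilon> :: real assume \<epsilon>: "\<epsilon> > 0"
    define N where "N = p -` (ball u0 (d / 2) \<times> ball x0 \<epsilon>)"
    define S where "S = p -` W"
    have NS: "open N" "open S"
      unfolding N_def S_def
      by (intro open_vimage pc open_Times open_ball W)+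
    have z: "0 \<in> N" "0 \<in> S" unfolding N_def S_def using p0 dM(1) \<epsilon> W by auto
    have "continuous_on S (F \<circ> p)"
    proof (rule continuous_on_compose)
      show "continuous_on S p" using pc continuous_on_subset by blast
      show "continuous_on (p ` S) F"
        using has_derivative_continuous[OF smooth_on_has_derivative[OF smooth]]
        by (intro continuous_at_imp_continuous_on) (metis S_def imageE vimageE)
    qed
    from sussmann_open_mapping[OF NS(2) this z(2) Fp bounded_linear_ident, of "N \<inter> S"]
    have "(F \<circ> p) 0 \<in> interior ((F \<circ> p) ` (N \<inter> S))"
      using NS z by (auto simp: id_def o_def interior_open open_Int)
    then have "x0 \<in> interior ((F \<circ> p) ` (N \<inter> S))" by (simp add: p0 F0)
    then obtain \<eta> where \<eta>: "\<eta> > 0" "ball x0 \<eta> \<subseteq> (F \<circ> p) ` (N \<inter> S)"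
      by (auto simp: mem_interior)
    show "\<exists>\<eta>>0. \<forall>x\<in>ball x0 \<eta>. \<exists>g\<in>carrier G. \<exists>y \<in> ball x0 \<epsilon> \<inter> (L + {x0}). x = act g y \<and>
       (\<forall>z\<in>ball x0 (d / 2). \<forall>v. norm (frechet_derivative (act g) (at z) v) \<le> M * norm v)"
    proof (intro exI[of _ \<eta>] conjI ballI \<eta>(1))
      fix x assume "x \<in> ball x0 \<eta>"
      then obtain t where t: "t \<in> N" "t \<in> S" "x = F (p t)" using \<eta>(2) by auto
      define g where "g = inv_into U \<phi> (u0 + R t)"
      have u: "u0 + R t \<in> \<phi> ` U" "u0 + R t \<in> ball u0 (d / 2)" "x0 + Q t \<in> ball x0 \<epsilon>"
        using t(1,2) unfolding S_def N_def W_def p_def by auto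
      have "g \<in> U" unfolding g_def using u(1) by (rule inv_into_into)
      then have g: "g \<in> carrier G" using chart_subset_carrier[OF c(1)] by blast
      have y: "x0 + Q t \<in> ball x0 \<epsilon> \<inter> (L + {x0})"
        using u(3) RQ(3) by (force simp: set_plus_def add.commute)
      have x: "x = act g (x0 + Q t)" using t(3) unfolding F_def p_def g_def by simp
      have bound: "norm (frechet_derivative (act g) (at z) v) \<le> M * norm v"
        if z: "z \<in> ball x0 (d / 2)" for z v
      proof -
        have "dist (u0, x0) (u0 + R t, z) \<le> dist u0 (u0 + R t) + dist x0 z"
          unfolding dist_Pair_Pair by (rule sqrt_sum_squares_le_sum) auto
        also have "\<dots> < d" using u(2) z by simp
        finally have q: "(u0 + R t, z) \<in> ball (u0, x0) d" by simp
        have "frechet_derivative (act g) (at z) = (\<lambda>v. frechet_derivative F (at (u0 + R t, z)) (0, v))"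
          using frechet_derivative_at[OF action_has_derivative_in_chart[OF c(1) u(1)]]
          unfolding g_def F_def by simp
        then show ?thesis using dM(4)[OF q] by simp
      qed
      show "\<exists>g\<in>carrier G. \<exists>y \<in> ball x0 \<epsilon> \<inter> (L + {x0}). x = act g y \<and>
       (\<forall>z\<in>ball x0 (d / 2). \<forall>v. norm (frechet_derivative (act g) (at z) v) \<le> M * norm v)"
        using g y x bound by blast
    qed
  qed
qed

section \<open>Transporting the two inequalities along the action\<close>

text \<open>
  The map \<open>h\<close> is Lipschitz only near \<open>x0\<close>, whereas the distance to \<open>S\<close> involves all of \<open>S\<close>. As
  \<open>x0 \<in> S\<close> and \<open>y\<close> is within \<open>\<delta> / 2\<close> of \<open>x0\<close>, a point of \<open>S\<close> outside \<open>ball x0 \<delta>\<close> is farther from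
  \<open>y\<close> than \<open>x0\<close> is, and may be replaced by \<open>x0\<close>.
\<close>

lemma infdist_image_le:
  assumes lip: "\<And>a b. a \<in> ball x0 \<delta> \<Longrightarrow> b \<in> ball x0 \<delta> \<Longrightarrow> dist (h a) (h b) \<le> M * dist a b"
    and "h ` S \<subseteq> S" "x0 \<in> S" "y \<in> ball x0 (\<delta> / 2)" "M > 0"
  shows "infdist (h y) S \<le> M * infdist y S"
proof -
  have \<delta>: "dist x0 y < \<delta> / 2" "0 < \<delta>" using assms(4) zero_le_dist[of x0 y] by (auto simp del: zero_le_dist)
  then have y: "y \<in> ball x0 \<delta>" by simp
  have near: "infdist (h y) S \<le> M * dist y s" if "s \<in> S" "s \<in> ball x0 \<delta>" for s
  proof -
    have "infdist (h y) S \<le> dist (h y) (h s)" using assms(2) that(1) by (intro infdist_le) auto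
    also have "\<dots> \<le> M * dist y s" by (rule lip[OF y that(2)])
    finally show ?thesis .
  qed
  have all: "infdist (h y) S / M \<le> dist y s" if s: "s \<in> S" for s
  proof (cases "s \<in> ball x0 \<delta>")
    case True
    then show ?thesis using near[OF s] \<open>M > 0\<close> by (simp add: pos_divide_le_eq mult.commute)
  next
    case False
    have "infdist (h y) S \<le> M * dist y x0" using near[OF assms(3)] \<delta>(2) by simp
    moreover have "dist y x0 \<le> dist y s"
      using False \<delta>(1) dist_triangle[of x0 s y] by (simp add: dist_commute)
    then have "M * dist y x0 \<le> M * dist y s" using \<open>M > 0\<close> by simp
    ultimately have "infdist (h y) S \<le> M * dist y s" by (rule order_trans)
    then show ?thesis using \<open>M > 0\<close> by (simp add: pos_divide_le_eq mult.commute)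
  qed
  have "infdist (h y) S / M \<le> infdist y S"
    unfolding infdist_notempty[OF ex_in_conv[THEN iffD1, OF exI, OF assms(3)], of y]
    using assms(3) all by (intro cINF_greatest) auto
  then show ?thesis using \<open>M > 0\<close> by (simp add: pos_divide_le_eq mult.commute)
qed

lemma growth_ineq_transport:
  assumes "growth_ineq f x0 \<kappa> \<beta> y" "f x = f y" "\<kappa> \<ge> 0" "M > 0" "\<beta> \<ge> 0"
    and "infdist x {z. f z \<le> f x0} \<le> M * infdist y {z. f z \<le> f x0}"
  shows "growth_ineq f x0 (\<kappa> * (1 / M) powr \<beta>) \<beta> x"
proof -
  let ?S = "{z. f z \<le> f x0}"
  have "\<kappa> * (1 / M) powr \<beta> * infdist x ?S powr \<beta> = \<kappa> * (1 / M * infdist x ?S) powr \<beta>"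
    using assms(4) by (simp only: powr_mult mult.assoc)
  also have "\<dots> \<le> \<kappa> * infdist y ?S powr \<beta>"
    using assms(3-6)
    by (intro mult_left_mono powr_mono2) (auto simp: pos_divide_le_eq mult.commute infdist_nonneg)
  finally have "ereal (\<kappa> * (1 / M) powr \<beta> * infdist x ?S powr \<beta>) \<le> ereal (\<kappa> * infdist y ?S powr \<beta>)"
    by simp
  also have "\<dots> \<le> max (f x - f x0) 0" using assms(1,2) by (simp add: growth_ineq_def)
  finally show ?thesis by (simp add: growth_ineq_def)
qed

text \<open>
  For invariant \<open>f\<close> the adjoint of the derivative of \<open>h\<close> at \<open>y\<close>, whose norm is at most \<open>M\<close>, maps
  subgradients at \<open>h y\<close> to subgradients at \<open>y\<close>. Short subgradients at \<open>h y\<close> would thus produce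
  short ones at \<open>y\<close>.
\<close>

lemma KL_ineq_transport:
  fixes h :: "'a::euclidean_space \<Rightarrow> 'a"
  assumes D: "\<And>z. (h has_derivative D z) (at z)"
    and Dcont: "\<And>w. continuous_on UNIV (\<lambda>z. D z w)"
    and hom: "homeomorphism UNIV UNIV h k"
    and inv: "f \<circ> h = f" and bound: "\<And>w. norm (D y w) \<le> M * norm w" "M > 0"
    and KL: "KL_ineq f x0 c \<alpha> y"
  shows "KL_ineq f x0 (c / M) \<alpha> (h y)"
proof -
  have f: "f (h y) = f y" using inv by (metis comp_apply)
  have "ereal (c / M * real_of_ereal (f (h y) - f x0) powr \<alpha>) \<le> ereal (dist 0 v)"
    if v: "v \<in> clarke_subdiff f (h y)" for v
  proof -
    have "adjoint (D y) v \<in> clarke_subdiff f y"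
      using clarke_subdiff_compose[OF D Dcont hom, of y f] v inv by auto
    then have "edist_set 0 (clarke_subdiff f y) \<le> ereal (dist 0 (adjoint (D y) v))"
      unfolding edist_set_def by (rule INF_lower)
    with KL have "ereal (c * real_of_ereal (f y - f x0) powr \<alpha>) \<le> ereal (dist 0 (adjoint (D y) v))"
      unfolding KL_ineq_def by (rule order_trans)
    then have "c * real_of_ereal (f y - f x0) powr \<alpha> \<le> norm (adjoint (D y) v)" by simp
    also have "\<dots> \<le> M * norm v"
      by (rule norm_adjoint_le[OF has_derivative_linear[OF D] bound(1)])
    finally show ?thesis using bound(2) by (simp add: f field_simps)
  qed
  then show ?thesis unfolding KL_ineq_def edist_set_def by (intro INF_greatest)
qed

section \<open>Growth and Kurdyka-Lojasiewicz exponents from a transversal slice\<close>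

theorem theorem3p12:
  fixes G :: "('g, 'z) monoid_scheme"
    and T :: "'g topology"
    and A :: "('g, 'm::real_normed_vector) atlas"
    and act :: "'g \<Rightarrow> real ^ 'n \<Rightarrow> real ^ 'n"
    and f :: "real ^ 'n \<Rightarrow> ereal"
    and x0 :: "real ^ 'n"
    and L :: "(real ^ 'n) set"
  assumes "smooth_action G T A act"
    and "\<And>x. f x \<noteq> - \<infinity>"
    and "lower_semicontinuous f"
    and "group_invariant G act f"
    and "x0 \<in> effective_domain f"
    and "subspace L"
    and "orbit_tangent_space G A act x0 + L = UNIV"
  shows "(\<forall>\<rho>>0. \<forall>\<kappa>>0. \<forall>\<beta>\<ge>1.
            (\<forall>x \<in> ball x0 \<rho> \<inter> (L + {x0}). growth_ineq f x0 \<kappa> \<beta> x)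
            \<longrightarrow> has_growth_exponent f x0 \<beta>)
       \<and> (\<forall>r>0. \<forall>c>0. \<forall>l>0. \<forall>\<alpha>. 0 \<le> \<alpha> \<and> \<alpha> < 1 \<longrightarrow>
            (\<forall>x \<in> ball x0 r \<inter> {x. 0 < f x - f x0 \<and> f x - f x0 < ereal l} \<inter> (L + {x0}).
                KL_ineq f x0 c \<alpha> x)
            \<longrightarrow> has_KL_exponent f x0 \<alpha>)"
proof -
  interpret smooth_action G T A act by fact
  obtain M \<delta> where M: "M > 0" and \<delta>: "\<delta> > 0"
    and slice: "\<And>\<epsilon>. \<epsilon> > 0 \<Longrightarrow> \<exists>\<eta>>0. \<forall>x\<in>ball x0 \<eta>. \<exists>g\<in>carrier G. \<exists>y \<in> ball x0 \<epsilon> \<inter> (L + {x0}).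
       x = act g y \<and>
       (\<forall>z\<in>ball x0 \<delta>. \<forall>v. norm (frechet_derivative (act g) (at z) v) \<le> M * norm v)"
    using action_reaches_transversal_slice[OF assms(1,6,7)] by metis
  have f_act: "f (act g y) = f y" if "g \<in> carrier G" for g y
    using assms(4) that by (simp add: group_invariant_def)
  have growth: "has_growth_exponent f x0 \<beta>"
    if "\<rho> > 0" "\<kappa> > 0" "\<beta> \<ge> 1"
      and slice_growth: "\<forall>x \<in> ball x0 \<rho> \<inter> (L + {x0}). growth_ineq f x0 \<kappa> \<beta> x"
    for \<rho> \<kappa> \<beta> :: real
  proof -
    (* The radius \<rho> makes the hypothesis apply to the slice point, \<delta> / 2 makes the comparison of
       distances apply to it. *)
    obtain \<eta> where \<eta>: "\<eta> > 0" and reach: "\<And>x. x \<in> ball x0 \<eta> \<Longrightarrow>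
        \<exists>g\<in>carrier G. \<exists>y \<in> ball x0 (min \<rho> (\<delta> / 2)) \<inter> (L + {x0}). x = act g y \<and>
        (\<forall>z\<in>ball x0 \<delta>. \<forall>v. norm (frechet_derivative (act g) (at z) v) \<le> M * norm v)"
      using slice[of "min \<rho> (\<delta> / 2)"] \<open>\<rho> > 0\<close> \<delta> by auto
    have "growth_ineq f x0 (\<kappa> * (1 / M) powr \<beta>) \<beta> x" if "x \<in> ball x0 \<eta>" for x
    proof -
      obtain g y where g: "g \<in> carrier G" and y: "y \<in> ball x0 (min \<rho> (\<delta> / 2))" "y \<in> L + {x0}"
        and x: "x = act g y"
        and bound: "\<And>z v. z \<in> ball x0 \<delta> \<Longrightarrow> norm (frechet_derivative (act g) (at z) v) \<le> M * norm v"
        using reach[OF \<open>x \<in> ball x0 \<eta>\<close>] by blast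
      have lip: "dist (act g a) (act g b) \<le> M * dist a b"
        if "a \<in> ball x0 \<delta>" "b \<in> ball x0 \<delta>" for a b
        unfolding dist_norm
        by (rule differentiable_bound[OF convex_ball _ _ that,
              where f'="\<lambda>z. frechet_derivative (act g) (at z)"])
          (use act_C1(1)[OF g] bound in \<open>auto intro: has_derivative_at_withinI onorm_le\<close>)
      have "infdist x {z. f z \<le> f x0} \<le> M * infdist y {z. f z \<le> f x0}"
        unfolding x by (rule infdist_image_le[OF lip]) (use y M f_act[OF g] in auto)
      moreover have "growth_ineq f x0 \<kappa> \<beta> y" using slice_growth y by simp
      ultimately show ?thesis
        using \<open>\<kappa> > 0\<close> \<open>\<beta> \<ge> 1\<close> M f_act[OF g] x by (intro growth_ineq_transport[where y=y]) auto
    qed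
    moreover have "\<kappa> * (1 / M) powr \<beta> > 0" using \<open>\<kappa> > 0\<close> M by simp
    ultimately show ?thesis
      unfolding has_growth_exponent_def using \<open>\<beta> \<ge> 1\<close> assms(5) \<eta> by blast
  qed
  have KL: "has_KL_exponent f x0 \<alpha>"
    if "r > 0" "c > 0" "l > 0" "0 \<le> \<alpha>" "\<alpha> < 1"
      and slice_KL: "\<forall>x \<in> ball x0 r \<inter> {x. 0 < f x - f x0 \<and> f x - f x0 < ereal l} \<inter> (L + {x0}).
        KL_ineq f x0 c \<alpha> x"
    for r c l \<alpha> :: real
  proof -
    obtain \<eta> where \<eta>: "\<eta> > 0" and reach: "\<And>x. x \<in> ball x0 \<eta> \<Longrightarrow>
        \<exists>g\<in>carrier G. \<exists>y \<in> ball x0 (min r \<delta>) \<inter> (L + {x0}). x = act g y \<and>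
        (\<forall>z\<in>ball x0 \<delta>. \<forall>v. norm (frechet_derivative (act g) (at z) v) \<le> M * norm v)"
      using slice[of "min r \<delta>"] \<open>r > 0\<close> \<delta> by auto
    have "KL_ineq f x0 (c / M) \<alpha> x"
      if "x \<in> ball x0 \<eta>" "0 < f x - f x0 \<and> f x - f x0 < ereal l" for x
    proof -
      obtain g y where g: "g \<in> carrier G" and y: "y \<in> ball x0 (min r \<delta>)" "y \<in> L + {x0}"
        and x: "x = act g y"
        and bound: "\<And>z v. z \<in> ball x0 \<delta> \<Longrightarrow> norm (frechet_derivative (act g) (at z) v) \<le> M * norm v"
        using reach[OF \<open>x \<in> ball x0 \<eta>\<close>] by blast
      have "KL_ineq f x0 c \<alpha> y" using slice_KL y that(2) f_act[OF g] x by simp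
      moreover have "f \<circ> act g = f" using f_act[OF g] by auto
      ultimately show ?thesis
        unfolding x using y(1) bound M
        by (intro KL_ineq_transport[OF act_C1[OF g] act_homeomorphism[OF g]]) auto
    qed
    moreover have "c / M > 0" using \<open>c > 0\<close> M by simp
    ultimately show ?thesis
      unfolding has_KL_exponent_def using that(3-5) assms(5) \<eta> by blast
  qed
  show ?thesis using growth KL by blast
qed

end
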